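(* For every integer $n\ge1$, in $\mathbb{Z}[\lambda,x_1,\dots,x_n]$, \[\prod_{1\le i<j\le n}(x_i+\lambda x_j)=\sum_{\alpha\in Y_n^+(\{r,b,g,y\})}\lambda^{E(\alpha)}\prod_{i=1}^{n-1}x_i^{\,n-i-E_i(\alpha)}\sum_{\alpha'}\ \prod_{m=1}^{n}x_m^{E^m(\alpha')},\] where the inner sum runs over all row shuffles $\alpha'$ of $\alpha$; and \[(1+\lambda)^{\binom n2}=\sum_{\alpha\in Y_n^+(\{r,b,g,y\})}\lambda^{E(\alpha)}\prod_{1\le i\le k\le n-1}\binom{C_{i+1,k}(\alpha)}{E_{i,k}(\alpha)}.\]
   Context: $Y_n^+(\{r,b,g\})$ is the set of integer arrays $\alpha=(\alpha_{i,j})$ indexed by $1\le i\le n$, $0\le j\le n-i$, such that $\alpha_{i,0}=i$, $i\le\alpha_{i,j}\le i+j$ for all entries, and, whenever both entries involved are defined, $\alpha_{i,j}\le\alpha_{i-1,j+1}+1$ and $\alpha_{i,j}\le\alpha_{i+1,j-1}$. $Y_n^+(\{r,b,g,y\})$ is the subset of those arrays which additionally satisfy $\alpha_{i,j}\le\alpha_{i,j+1}$ whenever both are defined. For $j\ge1$ the southwest neighbor of $\alpha_{i,j}$ is $\alpha_{i+1,j-1}$. $E(\alpha)$ is the number of entries ($j\ge1$) equal to their southwest neighbor; $E_i(\alpha)$ is the number of such entries in row $i$; $E_{i,k}(\alpha)$ is the number of such entries in row $i$ having value $k$; $E^m(\alpha)$ is the number of such entries $\alpha_{i,j}$ with $i+j=m$.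 $C_{i,k}(\alpha)$ is the number of entries in row $i$ (including column $0$) with value $k$. A row shuffle of $\alpha\in Y_n^+(\{r,b,g,y\})$ is an array $\alpha'\in Y_n^+(\{r,b,g\})$ obtained from $\alpha$ by permuting the entries within each row; the inner sum is over the distinct such arrays. *)

theory Defs
  imports "HOL-Library.Poly_Mapping" "HOL-Library.FuncSet"
begin

text \<open>
  Polynomials over the integers in the indeterminates \<open>\<lambda>\<close> and \<open>x\<^sub>0, x\<^sub>1, x\<^sub>2, \<dots>\<close>: finitely supported
  functions from monomials to coefficients, a monomial being a finitely supported exponent
  function; the multiplication of \<^type>\<open>poly_mapping\<close> is the convolution product.
  The ring \<open>\<int>[\<lambda>, x\<^sub>1, \<dots>, x\<^sub>n]\<close> is the subring of polynomials in which only \<open>\<lambda>, x\<^sub>1, \<dots>, x\<^sub>n\<close> occur.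
\<close>

datatype indet = Lambda | X nat

type_synonym int_mpoly = "(indet \<Rightarrow>\<^sub>0 nat) \<Rightarrow>\<^sub>0 int"

definition indet_poly :: "indet \<Rightarrow> int_mpoly" where
  "indet_poly v = Poly_Mapping.single (Poly_Mapping.single v 1) 1"

abbreviation lam :: int_mpoly where
  "lam \<equiv> indet_poly Lambda"

abbreviation xv :: "nat \<Rightarrow> int_mpoly" where
  "xv i \<equiv> indet_poly (X i)"

text \<open>
  An array is a function of the pair \<open>(i, j)\<close>. To make an array determined by its entries, it is
  required to be \<^const>\<open>extensional\<close>, i.e. to take a fixed dummy value off its index set.
\<close>

type_synonym int_array = "nat \<times> nat \<Rightarrow> int"

definition cells :: "nat \<Rightarrow> (nat \<times> nat) set" where
  "cells n = {(i, j). 1 \<le> i \<and> i \<le> n \<and> j \<le> n - i}"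

text \<open>
  The two neighbor inequalities relate \<open>(i, j)\<close> to \<open>(i - 1, j + 1)\<close> and to \<open>(i + 1, j - 1)\<close>; both are
  index-shifted below so that no truncated subtraction occurs.
\<close>

definition Y_rbg :: "nat \<Rightarrow> int_array set" where
  "Y_rbg n = {\<alpha> \<in> extensional (cells n).
     (\<forall>i. (i, 0) \<in> cells n \<longrightarrow> \<alpha> (i, 0) = int i) \<and>
     (\<forall>i j. (i, j) \<in> cells n \<longrightarrow> int i \<le> \<alpha> (i, j) \<and> \<alpha> (i, j) \<le> int (i + j)) \<and>
     (\<forall>i j. (i + 1, j) \<in> cells n \<and> (i, j + 1) \<in> cells n \<longrightarrow> \<alpha> (i + 1, j) \<le> \<alpha> (i, j + 1) + 1) \<and>
     (\<forall>i j. (i, j + 1) \<in> cells n \<and> (i + 1, j) \<in> cells n \<longrightarrow> \<alpha> (i, j + 1) \<le> \<alpha> (i + 1, j))}"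

definition Y_rbgy :: "nat \<Rightarrow> int_array set" where
  "Y_rbgy n = {\<alpha> \<in> Y_rbg n.
     \<forall>i j. (i, j) \<in> cells n \<and> (i, j + 1) \<in> cells n \<longrightarrow> \<alpha> (i, j) \<le> \<alpha> (i, j + 1)}"

text \<open>
  For \<open>(i, j)\<close> in the index set with \<open>j \<ge> 1\<close>, the southwest position \<open>(i + 1, j - 1)\<close> is always in the
  index set.
\<close>

definition sw_equal :: "nat \<Rightarrow> int_array \<Rightarrow> (nat \<times> nat) set" where
  "sw_equal n \<alpha> = {(i, j). (i, j) \<in> cells n \<and> 1 \<le> j \<and> \<alpha> (i, j) = \<alpha> (i + 1, j - 1)}"

definition E_total :: "nat \<Rightarrow> int_array \<Rightarrow> nat" where
  "E_total n \<alpha> = card (sw_equal n \<alpha>)"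

definition E_row :: "nat \<Rightarrow> int_array \<Rightarrow> nat \<Rightarrow> nat" where
  "E_row n \<alpha> i = card {j. (i, j) \<in> sw_equal n \<alpha>}"

definition E_row_val :: "nat \<Rightarrow> int_array \<Rightarrow> nat \<Rightarrow> int \<Rightarrow> nat" where
  "E_row_val n \<alpha> i k = card {j. (i, j) \<in> sw_equal n \<alpha> \<and> \<alpha> (i, j) = k}"

definition E_diag :: "nat \<Rightarrow> int_array \<Rightarrow> nat \<Rightarrow> nat" where
  "E_diag n \<alpha> m = card {(i, j). (i, j) \<in> sw_equal n \<alpha> \<and> i + j = m}"

definition C_row_val :: "nat \<Rightarrow> int_array \<Rightarrow> nat \<Rightarrow> int \<Rightarrow> nat" where
  "C_row_val n \<alpha> i k = card {j. (i, j) \<in> cells n \<and> \<alpha> (i, j) = k}"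

definition row_shuffles :: "nat \<Rightarrow> int_array \<Rightarrow> int_array set" where
  "row_shuffles n \<alpha> = {\<alpha>' \<in> Y_rbg n.
     \<forall>i\<in>{1..n}. \<exists>\<sigma>. bij_betw \<sigma> {0..n - i} {0..n - i} \<and> (\<forall>j\<in>{0..n - i}. \<alpha>' (i, j) = \<alpha> (i, \<sigma> j))}"

text \<open>
  The finiteness facts matter because \<^const>\<open>sum\<close> is \<open>0\<close> on infinite sets; the bound on \<^const>\<open>E_row\<close>
  shows that the exponent \<open>n - i - E_row n \<alpha> i\<close> is never truncated.
\<close>

lemma finite_cells: "finite (cells n)"
  by (rule finite_subset[of _ "{0..n} \<times> {0..n}"]) (auto simp: cells_def)

lemma finite_Y_rbg: "finite (Y_rbg n)"
proof (rule finite_subset)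
  show "Y_rbg n \<subseteq> PiE (cells n) (\<lambda>(i, j). {int i..int (i + j)})"
    by (auto simp: Y_rbg_def PiE_def Pi_def)
  show "finite (PiE (cells n) (\<lambda>(i, j). {int i..int (i + j)}))"
    by (intro finite_PiE finite_cells) auto
qed

lemma finite_Y_rbgy: "finite (Y_rbgy n)"
  by (rule finite_subset[OF _ finite_Y_rbg]) (auto simp: Y_rbgy_def)

lemma finite_row_shuffles: "finite (row_shuffles n \<alpha>)"
  by (rule finite_subset[OF _ finite_Y_rbg]) (auto simp: row_shuffles_def)

lemma E_row_le: "E_row n \<alpha> i \<le> n - i"
proof -
  have "E_row n \<alpha> i \<le> card {1..n - i}"
    unfolding E_row_def by (rule card_mono) (auto simp: sw_equal_def cells_def)
  then show ?thesis by simp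
qed

end

theory Submission
  imports Defs
begin

text \<open>
  Along an antidiagonal \<open>i + j = m\<close> an array starts with the value \<open>m\<close> in column \<open>0\<close> and each step to the
  upper right keeps the value or lowers it by one; hence an array of \<open>Y_rbg n\<close> amounts to an arbitrary
  set of pairs \<open>(i, m)\<close>, those where the value is kept, and expanding the product
  \<open>\<Prod>(x\<^sub>i + \<lambda> x\<^sub>m)\<close> gives a sum over \<open>Y_rbg n\<close>. Sorting every row of such an array yields an
  array of \<open>Y_rbgy n\<close>, so the sets of row shuffles partition \<open>Y_rbg n\<close>. The number of kept values \<open>k\<close> in
  each row is determined by the multisets of entries of the rows and conversely, so \<open>E\<close> and \<open>E\<^sub>i\<close> are constant on each
  part, and the row shuffles are counted by choosing, from the bottom row upwards, which of the
  entries \<open>k\<close> of row \<open>i + 1\<close> are kept.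
\<close>

section \<open>Arrays encoded as sets of pairs\<close>

definition pairs :: "nat \<Rightarrow> (nat \<times> nat) set" where
  "pairs n = {(i, m). 1 \<le> i \<and> i < m \<and> m \<le> n}"

text \<open>\<open>level S i m\<close> is the entry in row \<open>i\<close> of antidiagonal \<open>m\<close>.\<close>

definition level :: "(nat \<times> nat) set \<Rightarrow> nat \<Rightarrow> nat \<Rightarrow> int" where
  "level S i m = int i + int (card {i'. i \<le> i' \<and> (i', m) \<in> S})"

definition array_of :: "nat \<Rightarrow> (nat \<times> nat) set \<Rightarrow> int_array" where
  "array_of n S = (\<lambda>(i, j). if (i, j) \<in> cells n then level S i (i + j) else undefined)"

text \<open>Cells are named by row and antidiagonal \<open>m = i + j\<close>, so that a kept value
  at \<open>(i, m)\<close> corresponds to choosing the second term of the factor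
  \<open>x i + l * x m\<close>.\<close>

definition pairs_of :: "nat \<Rightarrow> int_array \<Rightarrow> (nat \<times> nat) set" where
  "pairs_of n \<alpha> = {(i, m). i \<le> m \<and> (i, m - i) \<in> sw_equal n \<alpha>}"

lemma finite_pairs: "finite (pairs n)"
  by (rule finite_subset[of _ "{..n} \<times> {..n}"]) (auto simp: pairs_def)

lemma card_pairs: "card (pairs n) = n choose 2"
proof -
  have "card (pairs n) = (\<Sum>i = 1..n. card {m. i < m \<and> m \<le> n})"
  proof -
    have "pairs n = (SIGMA i:{1..n}. {m. i < m \<and> m \<le> n})"
      by (auto simp: pairs_def)
    then show ?thesis by simp
  qed
  also have "\<dots> = (\<Sum>i = 1..n. n - i)"
  proof (rule sum.cong)
    fix i
    have "{m. i < m \<and> m \<le> n} = {i<..n}" by auto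
    then show "card {m. i < m \<and> m \<le> n} = n - i" by simp
  qed simp
  also have "\<dots> = (\<Sum>i<n. i)"
    by (rule sum.reindex_bij_witness[of _ "\<lambda>i. n - i" "\<lambda>i. n - i"]) auto
  also have "\<dots> = n choose 2"
    by (cases n) (simp_all add: lessThan_Suc_atMost gauss_sum_nat choose_two atMost_atLeast0 mult.commute)
  finally show ?thesis .
qed

text \<open>Going from row \<open>Suc i\<close> up to row \<open>i\<close> lowers the summand
  \<open>int i\<close> by one, and the counted set gains \<open>i\<close> exactly when
  \<open>(i, m)\<close> lies in \<open>S\<close>.\<close>

lemma level_step:
  assumes "S \<subseteq> pairs n"
  shows "level S i m = level S (Suc i) m - (if (i, m) \<in> S then 0 else 1)"
proof -
  have fin: "finite {i'. Suc i \<le> i' \<and> (i', m) \<in> S}"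
    by (rule finite_subset[of _ "{..n}"]) (use assms in \<open>auto simp: pairs_def\<close>)
  have "{i'. i \<le> i' \<and> (i', m) \<in> S} =
      (if (i, m) \<in> S then insert i {i'. Suc i \<le> i' \<and> (i', m) \<in> S} else {i'. Suc i \<le> i' \<and> (i', m) \<in> S})"
    by (auto simp: Suc_le_eq le_less)
  then show ?thesis using fin by (simp add: level_def)
qed

lemma level_bounds:
  assumes "S \<subseteq> pairs n" "i \<le> m"
  shows "int i \<le> level S i m" "level S i m \<le> int m"
proof -
  have "card {i'. i \<le> i' \<and> (i', m) \<in> S} \<le> card {i..<m}"
    by (rule card_mono) (use assms in \<open>auto simp: pairs_def\<close>)
  then show "level S i m \<le> int m" using assms by (simp add: level_def)
qed (simp add: level_def)

lemma level_diag:
  assumes "S \<subseteq> pairs n"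
  shows "level S m m = int m"
  using level_bounds[OF assms, of m m] by simp

lemma array_of_in_Y_rbg:
  assumes "S \<subseteq> pairs n"
  shows "array_of n S \<in> Y_rbg n"
proof -
  have "level S (Suc i) m \<le> level S i m + 1 \<and> level S i m \<le> level S (Suc i) m" for i m
    using level_step[OF assms, of i m] by (simp split: if_splits)
  moreover have "level S i (i + j) \<le> int i + int j" for i j
    using level_bounds(2)[OF assms, of i "i + j"] by simp
  ultimately show ?thesis
    using level_bounds(1)[OF assms] level_diag[OF assms]
    by (auto simp: Y_rbg_def array_of_def extensional_def)
qed

lemma mem_pairs_of_iff:
  "(i, m) \<in> pairs_of n \<alpha> \<longleftrightarrow> (i, m) \<in> pairs n \<and> \<alpha> (i, m - i) = \<alpha> (Suc i, m - Suc i)"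
  by (auto simp: pairs_of_def pairs_def sw_equal_def cells_def)

lemma pairs_of_subset: "pairs_of n \<alpha> \<subseteq> pairs n"
  by (auto simp: mem_pairs_of_iff)

lemma pairs_of_array_of:
  assumes "S \<subseteq> pairs n"
  shows "pairs_of n (array_of n S) = S"
proof -
  have "(i, m) \<in> pairs_of n (array_of n S) \<longleftrightarrow> (i, m) \<in> S" for i m
  proof (cases "(i, m) \<in> pairs n")
    case True
    then show ?thesis
      using level_step[OF assms, of i m]
      by (auto simp: mem_pairs_of_iff array_of_def cells_def pairs_def)
  next
    case False
    then show ?thesis using assms by (auto simp: mem_pairs_of_iff)
  qed
  then show ?thesis by auto
qed

text \<open>Induction along an antidiagonal: the southwest neighbor of \<open>(i, Suc j)\<close> is
  \<open>(Suc i, j)\<close>, so the column is the induction variable and the row stays arbitrary.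
  The neighbor inequalities leave only a drop by \<open>0\<close> or \<open>1\<close>, and
  \<open>pairs_of\<close> records which.\<close>

lemma Y_rbg_eq_level:
  assumes "\<alpha> \<in> Y_rbg n"
  shows "(i, j) \<in> cells n \<Longrightarrow> \<alpha> (i, j) = level (pairs_of n \<alpha>) i (i + j)"
proof (induction j arbitrary: i)
  case 0
  then show ?case using assms level_diag[OF pairs_of_subset] by (auto simp: Y_rbg_def)
next
  case (Suc j)
  have c: "(Suc i, j) \<in> cells n" using Suc.prems by (auto simp: cells_def)
  have "\<alpha> (Suc i, j) \<le> \<alpha> (i, Suc j) + 1" "\<alpha> (i, Suc j) \<le> \<alpha> (Suc i, j)"
    using assms c Suc.prems by (auto simp: Y_rbg_def)
  moreover have "(i, i + Suc j) \<in> pairs_of n \<alpha> \<longleftrightarrow> \<alpha> (i, Suc j) = \<alpha> (Suc i, j)"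
    using Suc.prems by (auto simp: mem_pairs_of_iff pairs_def cells_def)
  ultimately show ?case
    using Suc.IH[OF c] level_step[OF pairs_of_subset, of n \<alpha> i "i + Suc j"] by auto
qed

lemma array_of_pairs_of:
  assumes "\<alpha> \<in> Y_rbg n"
  shows "array_of n (pairs_of n \<alpha>) = \<alpha>"
proof (rule extensionalityI)
  show "array_of n (pairs_of n \<alpha>) \<in> extensional (cells n)"
    by (auto simp: array_of_def extensional_def)
  show "\<alpha> \<in> extensional (cells n)" using assms by (simp add: Y_rbg_def)
  show "array_of n (pairs_of n \<alpha>) p = \<alpha> p" if "p \<in> cells n" for p
    using that Y_rbg_eq_level[OF assms] by (cases p) (simp add: array_of_def)
qed

section \<open>The statistics in terms of pairs\<close>

lemma E_total_eq: "E_total n \<alpha> = card (pairs_of n \<alpha>)"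
proof -
  have "bij_betw (\<lambda>(i, j). (i, i + j)) (sw_equal n \<alpha>) (pairs_of n \<alpha>)"
    by (rule bij_betw_byWitness[where f' = "\<lambda>(i, m). (i, m - i)"])
      (auto simp: pairs_of_def)
  then show ?thesis unfolding E_total_def by (rule bij_betw_same_card)
qed

lemma E_row_eq: "E_row n \<alpha> i = card {m. (i, m) \<in> pairs_of n \<alpha>}"
proof -
  have "bij_betw (\<lambda>j. i + j) {j. (i, j) \<in> sw_equal n \<alpha>} {m. (i, m) \<in> pairs_of n \<alpha>}"
    by (rule bij_betw_byWitness[where f' = "\<lambda>m. m - i"]) (auto simp: pairs_of_def)
  then show ?thesis unfolding E_row_def by (rule bij_betw_same_card)
qed

lemma E_diag_eq: "E_diag n \<alpha> m = card {i. (i, m) \<in> pairs_of n \<alpha>}"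
proof -
  have "bij_betw fst {(i, j). (i, j) \<in> sw_equal n \<alpha> \<and> i + j = m} {i. (i, m) \<in> pairs_of n \<alpha>}"
    by (rule bij_betw_byWitness[where f' = "\<lambda>i. (i, m - i)"]) (auto simp: pairs_of_def)
  then show ?thesis unfolding E_diag_def by (rule bij_betw_same_card)
qed

text \<open>The counterparts of \<open>C_row_val\<close> and \<open>E_row_val\<close> for a bare set
  of pairs, so that the row-by-row construction below need not pass through arrays.\<close>

definition row_count :: "nat \<Rightarrow> (nat \<times> nat) set \<Rightarrow> nat \<Rightarrow> int \<Rightarrow> nat" where
  "row_count n S i k = card {m \<in> {i..n}. level S i m = k}"

definition pair_count :: "(nat \<times> nat) set \<Rightarrow> nat \<Rightarrow> int \<Rightarrow> nat" where
  "pair_count S i k = card {m. (i, m) \<in> S \<and> level S i m = k}"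

lemma C_row_val_eq:
  assumes "\<alpha> \<in> Y_rbg n" "1 \<le> i" "i \<le> n"
  shows "C_row_val n \<alpha> i k = row_count n (pairs_of n \<alpha>) i k"
proof -
  have "bij_betw (\<lambda>j. i + j) {j. (i, j) \<in> cells n \<and> \<alpha> (i, j) = k}
      {m \<in> {i..n}. level (pairs_of n \<alpha>) i m = k}"
    by (rule bij_betw_byWitness[where f' = "\<lambda>m. m - i"])
      (use assms Y_rbg_eq_level[OF assms(1)] in \<open>auto simp: cells_def\<close>)
  then show ?thesis unfolding C_row_val_def row_count_def by (rule bij_betw_same_card)
qed

lemma E_row_val_eq:
  assumes "\<alpha> \<in> Y_rbg n"
  shows "E_row_val n \<alpha> i k = pair_count (pairs_of n \<alpha>) i k"
proof -
  have "bij_betw (\<lambda>j. i + j) {j. (i, j) \<in> sw_equal n \<alpha> \<and> \<alpha> (i, j) = k}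
      {m. (i, m) \<in> pairs_of n \<alpha> \<and> level (pairs_of n \<alpha>) i m = k}"
    by (rule bij_betw_byWitness[where f' = "\<lambda>m. m - i"])
      (use assms Y_rbg_eq_level[OF assms(1)] in \<open>auto simp: pairs_of_def sw_equal_def\<close>)
  then show ?thesis unfolding E_row_val_def pair_count_def by (rule bij_betw_same_card)
qed

section \<open>Value counts of adjacent rows\<close>

lemma finite_pair_row: "S \<subseteq> pairs n \<Longrightarrow> finite {m. (i, m) \<in> S}"
  by (rule finite_subset[of _ "{..n}"]) (auto simp: pairs_def)

lemma pair_count_eq_0:
  assumes "S \<subseteq> pairs n" "k < int i \<or> int n < k"
  shows "pair_count S i k = 0"
proof -
  have "{m. (i, m) \<in> S \<and> level S i m = k} = {}"
  proof (safe, goal_cases)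
    case (1 m)
    then have "i \<le> m" "m \<le> n" using assms(1) by (auto simp: pairs_def)
    then show ?case using level_bounds[OF assms(1) \<open>i \<le> m\<close>] 1 assms(2) by auto
  qed
  then show ?thesis by (simp only: pair_count_def card.empty)
qed

text \<open>The entries \<open>k\<close> of row \<open>i\<close> are the column \<open>0\<close>
  entry if \<open>k = i\<close> (\<open>D\<close>), the kept ones (\<open>A\<close>), and those
  lowered from a \<open>k + 1\<close> in row \<open>Suc i\<close> (\<open>N\<close>). The entries
  \<open>k + 1\<close> of row \<open>Suc i\<close> are either lowered (\<open>N\<close>) or kept
  (\<open>B\<close>). Eliminating the size of \<open>N\<close> gives the identity, written without
  subtraction.\<close>

lemma row_count_recurrence:
  assumes S: "S \<subseteq> pairs n" and i: "1 \<le> i" "i < n"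
  shows "row_count n S i k + pair_count S i (k + 1) =
    (if k = int i then 1 else 0) + pair_count S i k + row_count n S (Suc i) (k + 1)"
proof -
  define N where "N = {m \<in> {Suc i..n}. (i, m) \<notin> S \<and> level S (Suc i) m = k + 1}"
  define A where "A = {m. (i, m) \<in> S \<and> level S i m = k}"
  define B where "B = {m. (i, m) \<in> S \<and> level S i m = k + 1}"
  define D where "D = (if k = int i then {i} else {})"
  have fin: "finite A" "finite B" "finite N" "finite D"
    using finite_pair_row[OF S, of i] by (simp_all add: A_def B_def N_def D_def)
  have low: "i < m" "m \<le> n" if "(i, m) \<in> S" for m using S that by (auto simp: pairs_def)
  have 1: "{m \<in> {i..n}. level S i m = k} = D \<union> A \<union> N"
  proof (intro set_eqI)
    fix m
    consider "m < i" | "m = i" | "i < m" by linarith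
    then show "m \<in> {m \<in> {i..n}. level S i m = k} \<longleftrightarrow> m \<in> D \<union> A \<union> N"
    proof cases
      case 3
      then show ?thesis
        using level_step[OF S, of i m] low[of m] by (auto simp: A_def N_def D_def)
    qed (use low level_diag[OF S, of i] i in \<open>auto simp: A_def N_def D_def dest: low\<close>)
  qed
  have 2: "{m \<in> {Suc i..n}. level S (Suc i) m = k + 1} = B \<union> N"
  proof (intro set_eqI)
    fix m
    show "m \<in> {m \<in> {Suc i..n}. level S (Suc i) m = k + 1} \<longleftrightarrow> m \<in> B \<union> N"
      using level_step[OF S, of i m] low[of m] by (auto simp: B_def N_def)
  qed
  have "D \<inter> A = {}" "(D \<union> A) \<inter> N = {}" "B \<inter> N = {}"
    using S by (auto simp: A_def B_def N_def D_def pairs_def)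
  then have "row_count n S i k = card D + card A + card N"
    "row_count n S (Suc i) (k + 1) = card B + card N"
    unfolding row_count_def 1 2 using fin by (simp_all add: card_Un_disjoint)
  then show ?thesis by (simp add: pair_count_def A_def B_def D_def)
qed

text \<open>Row \<open>n\<close> consists of the single entry \<open>n\<close>; from there
  \<open>row_count_recurrence\<close> computes each row from the one below it and the pair
  counts.\<close>

lemma row_count_cong:
  assumes S: "S \<subseteq> pairs n" "S' \<subseteq> pairs n" and r: "1 \<le> r" "r \<le> n"
    and eq: "\<And>i k. r \<le> i \<Longrightarrow> i < n \<Longrightarrow> pair_count S i k = pair_count S' i k"
  shows "row_count n S r k = row_count n S' r k"
  using r(2,1) eq
proof (induction r arbitrary: k rule: inc_induct)
  case base
  have "{m \<in> {n..n}. level S n m = k} = {m \<in> {n..n}. level S' n m = k}" for k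
    using level_diag[OF S(1)] level_diag[OF S(2)] by auto
  then show ?case unfolding row_count_def by metis
next
  case (step r)
  have "row_count n S (Suc r) k = row_count n S' (Suc r) k" for k
    using step by simp
  moreover have "pair_count S r k = pair_count S' r k" for k
    using step by simp
  ultimately show ?case
    using row_count_recurrence[OF S(1), of r k] row_count_recurrence[OF S(2), of r k] step
    by simp
qed

text \<open>Converse of \<open>row_count_cong\<close>: the recurrence expresses the pair count at
  \<open>k\<close> through the one at \<open>k + 1\<close> and row counts. The induction descends in
  \<open>k\<close>, starting above \<open>n\<close>, where all pair counts vanish.\<close>

lemma pair_count_cong:
  assumes S: "S \<subseteq> pairs n" "S' \<subseteq> pairs n" and i: "1 \<le> i" "i < n"
    and eq: "\<And>k. row_count n S i k = row_count n S' i k"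
      "\<And>k. row_count n S (Suc i) k = row_count n S' (Suc i) k"
  shows "pair_count S i k = pair_count S' i k"
proof (induction "nat (int n + 1 - k)" arbitrary: k rule: less_induct)
  case less
  show ?case
  proof (cases "k \<le> int n")
    case True
    then have "pair_count S i (k + 1) = pair_count S' i (k + 1)" by (intro less) simp
    then show ?thesis
      using row_count_recurrence[OF S(1) i, of k] row_count_recurrence[OF S(2) i, of k] eq
      by simp
  next
    case False
    then show ?thesis using pair_count_eq_0[OF S(1)] pair_count_eq_0[OF S(2)] by simp
  qed
qed

section \<open>Counting by rows and by values\<close>

lemma card_row_eq_sum_pair_count:
  assumes "S \<subseteq> pairs n"
  shows "card {m. (i, m) \<in> S} = (\<Sum>k\<in>{int i..int n}. pair_count S i k)"
proof -
  have "(\<Sum>k\<in>{int i..int n}. \<Sum>m\<in>{m \<in> {m. (i, m) \<in> S}. level S i m = k}. 1) = (\<Sum>m\<in>{m. (i, m) \<in> S}. 1::nat)"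
  proof (rule sum.group)
    have "level S i m \<in> {int i..int n}" if "(i, m) \<in> S" for m
    proof -
      have "i \<le> m" "m \<le> n" using assms that by (auto simp: pairs_def)
      then show ?thesis using level_bounds[OF assms \<open>i \<le> m\<close>] by simp
    qed
    then show "level S i ` {m. (i, m) \<in> S} \<subseteq> {int i..int n}" by auto
  qed (use finite_pair_row[OF assms] in auto)
  then show ?thesis by (simp add: pair_count_def)
qed

lemma card_eq_sum_rows:
  assumes "S \<subseteq> pairs n"
  shows "card S = (\<Sum>i = 1..n - 1. card {m. (i, m) \<in> S})"
proof -
  have "S = (SIGMA i:{1..n - 1}. {m. (i, m) \<in> S})"
    using assms by (auto simp: pairs_def)
  then have "card S = card (SIGMA i:{1..n - 1}. {m. (i, m) \<in> S})" by simp
  also have "\<dots> = (\<Sum>i = 1..n - 1. card {m. (i, m) \<in> S})"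
    using finite_pair_row[OF assms] by (intro card_SigmaI) auto
  finally show ?thesis .
qed

text \<open>The fibres of \<open>f\<close> over \<open>K\<close> partition \<open>J\<close>, so
  \<open>T\<close> amounts to an independent choice of a subset in each fibre.\<close>

lemma card_subsets_with_fibre_cards:
  assumes J: "finite J" and K: "finite K" "f ` J \<subseteq> K"
  shows "card {T. T \<subseteq> J \<and> (\<forall>k\<in>K. card {j \<in> T. f j = k} = e k)} =
    (\<Prod>k\<in>K. card {j \<in> J. f j = k} choose e k)"
proof -
  have "bij_betw (\<lambda>T. \<lambda>k\<in>K. {j \<in> T. f j = k})
      {T. T \<subseteq> J \<and> (\<forall>k\<in>K. card {j \<in> T. f j = k} = e k)}
      (PiE K (\<lambda>k. {U. U \<subseteq> {j \<in> J. f j = k} \<and> card U = e k}))"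
  proof (rule bij_betw_byWitness[where f' = "\<lambda>U. \<Union>k\<in>K. U k"], goal_cases)
    case 1
    then show ?case using K by auto
  next
    case 2
    show ?case
    proof
      fix U
      assume U: "U \<in> PiE K (\<lambda>k. {U. U \<subseteq> {j \<in> J. f j = k} \<and> card U = e k})"
      show "(\<lambda>k\<in>K. {j \<in> \<Union> (U ` K). f j = k}) = U"
      proof (rule extensionalityI[of _ K])
        show "U \<in> extensional K" using U by (simp add: PiE_def)
        show "(\<lambda>k\<in>K. {j \<in> \<Union> (U ` K). f j = k}) k = U k" if "k \<in> K" for k
          using U that by (force simp: PiE_iff)
      qed simp
    qed
  next
    case 3
    then show ?case by auto
  next
    case 4
    show ?case
    proof safe
      fix U
      assume U: "U \<in> PiE K (\<lambda>k. {U. U \<subseteq> {j \<in> J. f j = k} \<and> card U = e k})"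
      show "j \<in> J" if "k \<in> K" "j \<in> U k" for k j
        using U that by (auto simp: PiE_iff)
      show "card {j \<in> \<Union> (U ` K). f j = k} = e k" if "k \<in> K" for k
      proof -
        have "{j \<in> \<Union> (U ` K). f j = k} = U k" using U that by (force simp: PiE_iff)
        then show ?thesis using U that by (auto simp: PiE_iff)
      qed
    qed
  qed
  from bij_betw_same_card[OF this] show ?thesis
    using J K by (simp add: card_PiE n_subsets)
qed

text \<open>The intermediate stage of the count, with only the rows from \<open>r\<close> on filled
  in. For \<open>r = 1\<close> these are the pair sets of the row shuffles of the array belonging to
  \<open>S0\<close>.\<close>

definition matching_above :: "nat \<Rightarrow> (nat \<times> nat) set \<Rightarrow> nat \<Rightarrow> (nat \<times> nat) set set" where
  "matching_above n S0 r = {S. S \<subseteq> pairs n \<inter> {r..} \<times> UNIV \<and>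
     (\<forall>i k. r \<le> i \<and> i < n \<longrightarrow> pair_count S i k = pair_count S0 i k)}"

text \<open>A set on the rows from \<open>r\<close> on is a set \<open>S\<close> on the rows from
  \<open>Suc r\<close> on together with a row \<open>T\<close>. The admissible \<open>T\<close>
  (\<open>fib S\<close>) pick prescribed numbers of elements from the classes of equal value in row
  \<open>Suc r\<close>, whose sizes are the row counts.\<close>

lemma card_matching_above_step:
  assumes S0: "S0 \<subseteq> pairs n" and r: "1 \<le> r" "r < n"
  shows "card (matching_above n S0 r) = card (matching_above n S0 (Suc r)) *
    (\<Prod>k\<in>{int r..int n}. row_count n S0 (Suc r) k choose pair_count S0 r k)"
proof -
  define fib where "fib S = {T. T \<subseteq> {Suc r..n} \<and>
    (\<forall>k\<in>{int r..int n}. card {m \<in> T. level S (Suc r) m = k} = pair_count S0 r k)}" for S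
  \<comment> \<open>\<open>level\<close> at row \<open>i\<close> looks only at rows from
    \<open>i\<close> on, so adding or removing pairs in rows up to \<open>r\<close> leaves the later
    rows unchanged.\<close>
  have level_top: "level (S \<union> {r} \<times> T) i m = level S i m" if "r < i" for S T i m
    using that by (auto simp: level_def intro!: arg_cong[where f = card])
  have level_restrict: "level (S \<inter> {Suc r..} \<times> UNIV) i m = level S i m" if "r < i" for S i m
    using that by (auto simp: level_def intro!: arg_cong[where f = card])
  \<comment> \<open>A kept entry equals its southwest neighbor, so its value can be read off in row
    \<open>Suc r\<close>, before row \<open>r\<close> is chosen.\<close>
  have pc_row: "pair_count S r k = card {m \<in> {m. (r, m) \<in> S}. level S (Suc r) m = k}"
    if "S \<subseteq> pairs n" for S k
    using level_step[OF that, of r] by (auto simp: pair_count_def intro!: arg_cong[where f = card])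
  have "bij_betw (\<lambda>(S, T). S \<union> {r} \<times> T) (Sigma (matching_above n S0 (Suc r)) fib) (matching_above n S0 r)"
  proof (rule bij_betw_byWitness[where f' = "\<lambda>S. (S \<inter> {Suc r..} \<times> UNIV, {m. (r, m) \<in> S})"],
      goal_cases)
    case 1
    then show ?case by (auto simp: matching_above_def fib_def)
  next
    case 2
    show ?case
    proof
      fix S
      assume "S \<in> matching_above n S0 r"
      then have "i = r \<or> Suc r \<le> i" if "(i, m) \<in> S" for i m
        using that by (force simp: matching_above_def)
      then show "(case (S \<inter> {Suc r..} \<times> UNIV, {m. (r, m) \<in> S}) of (S, T) \<Rightarrow> S \<union> {r} \<times> T) = S"
        by auto
    qed
  next
    case 3
    show ?case
    proof safe
      fix S T
      assume S: "S \<in> matching_above n S0 (Suc r)" and T: "T \<in> fib S"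
      let ?S = "S \<union> {r} \<times> T"
      have sub: "?S \<subseteq> pairs n \<inter> {r..} \<times> UNIV"
        using S T r by (auto simp: matching_above_def fib_def pairs_def)
      have row: "{m. (r, m) \<in> ?S} = T" using S by (auto simp: matching_above_def)
      have "pair_count ?S i k = pair_count S0 i k" if i: "r \<le> i" "i < n" for i k
      proof (cases "i = r")
        case True
        show ?thesis
        proof (cases "k \<in> {int r..int n}")
          case k: True
          have "pair_count ?S r k = card {m \<in> T. level S (Suc r) m = k}"
            unfolding pc_row[OF subset_trans[OF sub Int_lower1]] row by (simp add: level_top)
          then show ?thesis using T k True by (simp add: fib_def)
        next
          \<comment> \<open>\<open>fib\<close> does not constrain values outside this range, but
            there both pair counts vanish.\<close>
          case False
          then show ?thesis
            using True pair_count_eq_0[OF S0, of k r]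
              pair_count_eq_0[OF subset_trans[OF sub Int_lower1], of k r] by auto
        qed
      next
        case False
        then have "pair_count ?S i k = pair_count S i k"
          using i by (simp add: pair_count_def level_top)
        then show ?thesis using S i False by (simp add: matching_above_def)
      qed
      then show "?S \<in> matching_above n S0 r" using sub by (simp add: matching_above_def)
    qed
  next
    case 4
    show ?case
    proof (rule image_subsetI)
      fix S
      assume S: "S \<in> matching_above n S0 r"
      let ?S = "S \<inter> {Suc r..} \<times> UNIV"
      have sub: "S \<subseteq> pairs n" using S by (auto simp: matching_above_def)
      have "pair_count ?S i k = pair_count S0 i k" if "Suc r \<le> i" "i < n" for i k
      proof -
        have "pair_count ?S i k = pair_count S i k"
          using that by (simp add: pair_count_def level_restrict)
        then show ?thesis using S that by (simp add: matching_above_def)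
      qed
      moreover have "{m. (r, m) \<in> S} \<in> fib ?S"
        using S r sub pc_row[OF sub]
        by (fastforce simp: fib_def matching_above_def level_restrict pairs_def)
      ultimately show "(?S, {m. (r, m) \<in> S}) \<in> Sigma (matching_above n S0 (Suc r)) fib"
        using S by (auto simp: matching_above_def)
    qed
  qed
  then have "card (matching_above n S0 r) = card (Sigma (matching_above n S0 (Suc r)) fib)"
    by (rule bij_betw_same_card[symmetric])
  also have "\<dots> = (\<Sum>S\<in>matching_above n S0 (Suc r). card (fib S))"
  proof (rule card_SigmaI)
    show "finite (matching_above n S0 (Suc r))"
      by (rule finite_subset[OF _ finite_Pow_iff[THEN iffD2, OF finite_pairs[of n]]])
        (auto simp: matching_above_def)
    show "\<forall>S\<in>matching_above n S0 (Suc r). finite (fib S)"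
      by (auto simp: fib_def intro: finite_subset[OF _ finite_Pow_iff[THEN iffD2, of "{Suc r..n}"]])
  qed
  also have "\<dots> = (\<Sum>S\<in>matching_above n S0 (Suc r).
      \<Prod>k\<in>{int r..int n}. row_count n S0 (Suc r) k choose pair_count S0 r k)"
  proof (rule sum.cong)
    fix S
    assume S: "S \<in> matching_above n S0 (Suc r)"
    then have sub: "S \<subseteq> pairs n" by (auto simp: matching_above_def)
    have "level S (Suc r) m \<in> {int r..int n}" if "m \<in> {Suc r..n}" for m
      using level_bounds[OF sub, of "Suc r" m] that by auto
    then have img: "level S (Suc r) ` {Suc r..n} \<subseteq> {int r..int n}" by blast
    have "card (fib S) = (\<Prod>k\<in>{int r..int n}. row_count n S (Suc r) k choose pair_count S0 r k)"
      using card_subsets_with_fibre_cards[OF _ _ img, of "pair_count S0 r"]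
      unfolding fib_def row_count_def by simp
    \<comment> \<open>Hence the number of choices for row \<open>r\<close> is the same for every
      \<open>S\<close>.\<close>
    moreover have "row_count n S (Suc r) k = row_count n S0 (Suc r) k" for k
      by (rule row_count_cong[OF sub S0]) (use S r in \<open>auto simp: matching_above_def\<close>)
    ultimately show "card (fib S) =
        (\<Prod>k\<in>{int r..int n}. row_count n S0 (Suc r) k choose pair_count S0 r k)"
      by simp
  qed simp
  finally show ?thesis by simp
qed

lemma card_matching_above:
  assumes S0: "S0 \<subseteq> pairs n" and r: "1 \<le> r" "r \<le> n"
  shows "card (matching_above n S0 r) =
    (\<Prod>i\<in>{r..<n}. \<Prod>k\<in>{int i..int n}. row_count n S0 (Suc i) k choose pair_count S0 i k)"
  using r(2,1)
proof (induction r rule: inc_induct)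
  case base
  have "pairs n \<inter> {n..} \<times> UNIV = {}" by (auto simp: pairs_def)
  then have "matching_above n S0 n = {{}}" by (auto simp: matching_above_def)
  then show ?case by simp
next
  case (step r)
  then show ?case
    using card_matching_above_step[OF S0 step.prems step.hyps(2)]
    by (simp add: prod.atLeast_Suc_lessThan[of r n] mult.commute)
qed

section \<open>Sorting the rows\<close>

lemma ex_sorting_bij:
  fixes f :: "nat \<Rightarrow> 'a::linorder"
  shows "\<exists>\<sigma>. bij_betw \<sigma> {0..N} {0..N} \<and> (\<forall>a b. a \<le> b \<and> b \<le> N \<longrightarrow> f (\<sigma> a) \<le> f (\<sigma> b))"
proof (intro exI conjI allI impI)
  \<comment> \<open>The indices, not the values, are sorted, so that the list itself is the
    permutation.\<close>
  let ?xs = "sort_key f [0..<Suc N]"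
  show "bij_betw ((!) ?xs) {0..N} {0..N}"
    by (rule bij_betw_nth) (auto simp del: upt_Suc)
  fix a b
  assume "a \<le> b \<and> b \<le> N"
  moreover have "sorted (map f ?xs)" by (rule sorted_sort_key)
  ultimately show "f (?xs ! a) \<le> f (?xs ! b)"
    using sorted_nth_mono[of "map f ?xs" a b] by (simp del: upt_Suc)
qed

text \<open>The counts on the right are unchanged by permuting the values of \<open>g\<close>.\<close>

lemma sorted_le_iff:
  fixes g :: "nat \<Rightarrow> 'a::linorder"
  assumes mono: "\<And>a b. a \<le> b \<Longrightarrow> b \<le> N \<Longrightarrow> g a \<le> g b" and j: "j \<le> N"
  shows "g j \<le> c \<longleftrightarrow> j < card {j' \<in> {0..N}. g j' \<le> c}"
proof
  assume "g j \<le> c"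
  then have "{0..j} \<subseteq> {j' \<in> {0..N}. g j' \<le> c}"
    using order_trans[OF mono[OF _ j]] j by auto
  from card_mono[OF _ this] show "j < card {j' \<in> {0..N}. g j' \<le> c}" by simp
next
  assume "j < card {j' \<in> {0..N}. g j' \<le> c}"
  moreover have "card {j' \<in> {0..N}. g j' \<le> c} \<le> card {0..<j}" if "\<not> g j \<le> c"
  proof (rule card_mono)
    show "{j' \<in> {0..N}. g j' \<le> c} \<subseteq> {0..<j}"
      using that mono by (auto simp: not_le intro: order_trans less_le_trans) (meson leI le_less_trans not_le)
  qed simp
  ultimately show "g j \<le> c" by force
qed

lemma card_Collect_bij_betw:
  assumes "bij_betw \<sigma> J J'"
  shows "card {j \<in> J. P (\<sigma> j)} = card {j \<in> J'. P j}"
proof -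
  have "bij_betw \<sigma> {j \<in> J. P (\<sigma> j)} {j \<in> J'. P j}"
    using assms by (auto simp: bij_betw_def inj_on_def)
  then show ?thesis by (rule bij_betw_same_card)
qed

lemma Y_rbgy_mono:
  assumes "\<alpha> \<in> Y_rbgy n" "1 \<le> i" "i \<le> n" "a \<le> b" "b \<le> n - i"
  shows "\<alpha> (i, a) \<le> \<alpha> (i, b)"
  using assms(4,5)
proof (induction b rule: dec_induct)
  case (step b)
  have "\<alpha> (i, b) \<le> \<alpha> (i, b + 1)"
    using assms step by (auto simp: Y_rbgy_def cells_def)
  then show ?case using step by simp
qed simp

text \<open>By \<open>sorted_le_iff\<close>, whether an entry of a sorted row is at most
  \<open>c\<close> depends only on how many entries of that row are, which is a sum of the
  counts.\<close>

lemma Y_rbgy_eqI: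
  assumes \<alpha>: "\<alpha> \<in> Y_rbgy n" and \<beta>: "\<beta> \<in> Y_rbgy n"
    and eq: "\<And>i k. i \<in> {1..n} \<Longrightarrow> C_row_val n \<alpha> i k = C_row_val n \<beta> i k"
  shows "\<alpha> = \<beta>"
proof (rule extensionalityI)
  show "\<alpha> \<in> extensional (cells n)" "\<beta> \<in> extensional (cells n)"
    using \<alpha> \<beta> by (auto simp: Y_rbgy_def Y_rbg_def)
  \<comment> \<open>The sum may start at \<open>int i\<close> since no entry of row \<open>i\<close>
    is smaller.\<close>
  have cum: "card {j \<in> {0..n - i}. \<gamma> (i, j) \<le> c} = (\<Sum>k\<in>{int i..c}. C_row_val n \<gamma> i k)"
    if "\<gamma> \<in> Y_rbgy n" "i \<in> {1..n}" for \<gamma> i c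
  proof -
    have "(\<Sum>k\<in>{int i..c}. \<Sum>j\<in>{j \<in> {j \<in> {0..n - i}. \<gamma> (i, j) \<le> c}. \<gamma> (i, j) = k}. 1) =
        (\<Sum>j\<in>{j \<in> {0..n - i}. \<gamma> (i, j) \<le> c}. 1::nat)"
      by (rule sum.group) (use that in \<open>auto simp: Y_rbgy_def Y_rbg_def cells_def\<close>)
    moreover have "{j \<in> {j \<in> {0..n - i}. \<gamma> (i, j) \<le> c}. \<gamma> (i, j) = k} = {j. (i, j) \<in> cells n \<and> \<gamma> (i, j) = k}"
      if "k \<in> {int i..c}" for k
      using \<open>i \<in> {1..n}\<close> that by (auto simp: cells_def)
    ultimately show ?thesis by (simp add: C_row_val_def)
  qed
  show "\<alpha> p = \<beta> p" if p: "p \<in> cells n" for p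
  proof -
    obtain i j where ij: "p = (i, j)" "i \<in> {1..n}" "j \<le> n - i"
      using p by (auto simp: cells_def)
    have "\<alpha> (i, j) \<le> c \<longleftrightarrow> \<beta> (i, j) \<le> c" for c
      using sorted_le_iff[of "n - i" "\<lambda>j. \<alpha> (i, j)" j c] sorted_le_iff[of "n - i" "\<lambda>j. \<beta> (i, j)" j c]
        Y_rbgy_mono[OF \<alpha>] Y_rbgy_mono[OF \<beta>] ij cum[OF \<alpha> ij(2)] cum[OF \<beta> ij(2)] eq[OF ij(2)]
      by simp
    then show ?thesis using ij(1) by (metis order.eq_iff)
  qed
qed

text \<open>Sorting the rows preserves the neighbor inequalities. With \<open>A i c\<close> the
  number of entries of row \<open>i\<close> that are at most \<open>c\<close>, these follow from
  \<open>Suc (A (Suc i) c) \<le> A i c\<close> and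
  \<open>A i c \<le> Suc (A (Suc i) (c + 1))\<close> for \<open>c \<ge> i\<close>, and such counts
  do not see the order within rows.\<close>

lemma ex_sorted_row_shuffle:
  assumes \<alpha>': "\<alpha>' \<in> Y_rbg n"
  shows "\<exists>\<alpha>\<in>Y_rbgy n. \<alpha>' \<in> row_shuffles n \<alpha>"
proof -
  have "\<forall>i. \<exists>\<sigma>. bij_betw \<sigma> {0..n - i} {0..n - i} \<and>
      (\<forall>a b. a \<le> b \<and> b \<le> n - i \<longrightarrow> \<alpha>' (i, \<sigma> a) \<le> \<alpha>' (i, \<sigma> b))"
    by (intro allI ex_sorting_bij)
  then obtain \<sigma> where \<sigma>: "\<And>i. bij_betw (\<sigma> i) {0..n - i} {0..n - i}"
    and mono: "\<And>i a b. a \<le> b \<Longrightarrow> b \<le> n - i \<Longrightarrow> \<alpha>' (i, \<sigma> i a) \<le> \<alpha>' (i, \<sigma> i b)"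
    by metis
  define \<alpha> where "\<alpha> = (\<lambda>(i, j). if (i, j) \<in> cells n then \<alpha>' (i, \<sigma> i j) else undefined)"
  have \<alpha>_eq: "\<alpha> (i, j) = \<alpha>' (i, \<sigma> i j)" if "(i, j) \<in> cells n" for i j
    using that by (simp add: \<alpha>_def)
  have in_cells: "(i, \<sigma> i j) \<in> cells n" if "(i, j) \<in> cells n" for i j
    using that bij_betwE[OF \<sigma>[of i]] by (auto simp: cells_def)
  define A where "A i c = card {j \<in> {0..n - i}. \<alpha>' (i, j) \<le> c}" for i c
  have le_iff: "\<alpha> (i, j) \<le> c \<longleftrightarrow> j < A i c" if "(i, j) \<in> cells n" for i j c
    using sorted_le_iff[of "n - i" "\<lambda>j. \<alpha>' (i, \<sigma> i j)" j c] mono[of _ _ i] that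
      card_Collect_bij_betw[OF \<sigma>, of i "\<lambda>j. \<alpha>' (i, j) \<le> c"]
    by (simp add: \<alpha>_eq A_def cells_def)
  have first: "\<alpha>' (i, 0) = int i" if "1 \<le> i" "i \<le> n" for i
    using \<alpha>' that by (auto simp: Y_rbg_def cells_def)
  have lower: "int i \<le> \<alpha> (i, j)" if "(i, j) \<in> cells n" for i j
    using \<alpha>' in_cells[OF that] that by (simp add: \<alpha>_eq Y_rbg_def)
  \<comment> \<open>The column \<open>0\<close> entry \<open>i\<close> is split off because it has
    no partner in row \<open>Suc i\<close>; column \<open>Suc j\<close> of row \<open>i\<close> is
    compared with column \<open>j\<close> of row \<open>Suc i\<close>.\<close>
  have A_Suc: "A i c = Suc (card {j \<in> {0..n - Suc i}. \<alpha>' (i, Suc j) \<le> c})"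
    if "1 \<le> i" "i < n" "int i \<le> c" for i c
  proof -
    have "{j \<in> {0..n - i}. \<alpha>' (i, j) \<le> c} = insert 0 (Suc ` {j \<in> {0..n - Suc i}. \<alpha>' (i, Suc j) \<le> c})"
    proof (intro set_eqI)
      fix j
      show "j \<in> {j \<in> {0..n - i}. \<alpha>' (i, j) \<le> c} \<longleftrightarrow>
          j \<in> insert 0 (Suc ` {j \<in> {0..n - Suc i}. \<alpha>' (i, Suc j) \<le> c})"
        using that first[of i] by (cases j) auto
    qed
    then show ?thesis by (simp add: A_def card_image)
  qed
  have step: "\<alpha>' (i, Suc j) \<le> \<alpha>' (Suc i, j)" "\<alpha>' (Suc i, j) \<le> \<alpha>' (i, Suc j) + 1"
    if "1 \<le> i" "i < n" "j \<le> n - Suc i" for i j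
    using \<alpha>' that by (auto simp: Y_rbg_def cells_def)
  have down: "\<alpha> (i, Suc j) \<le> \<alpha> (Suc i, j)" and up: "\<alpha> (Suc i, j) \<le> \<alpha> (i, Suc j) + 1"
    if c: "(i, Suc j) \<in> cells n" for i j
  proof -
    have i: "1 \<le> i" "i < n" and c': "(Suc i, j) \<in> cells n" using c by (auto simp: cells_def)
    let ?c = "\<alpha> (Suc i, j)"
    \<comment> \<open>\<open>le_iff\<close> with the entry itself as the bound, where its left side
      is trivial.\<close>
    have "j < A (Suc i) ?c" using le_iff[OF c'] by blast
    also have "Suc (A (Suc i) ?c) \<le> A i ?c"
    proof -
      have "A (Suc i) ?c \<le> card {j \<in> {0..n - Suc i}. \<alpha>' (i, Suc j) \<le> ?c}"
        unfolding A_def by (rule card_mono) (use step[OF i] in \<open>auto intro: order_trans\<close>)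
      then show ?thesis using A_Suc[OF i, of ?c] lower[OF c'] by simp
    qed
    finally show "\<alpha> (i, Suc j) \<le> ?c" using le_iff[OF c] by simp
    let ?d = "\<alpha> (i, Suc j)"
    have "Suc j < A i ?d" using le_iff[OF c] by blast
    also have "A i ?d \<le> Suc (A (Suc i) (?d + 1))"
    proof -
      have "card {j \<in> {0..n - Suc i}. \<alpha>' (i, Suc j) \<le> ?d} \<le> A (Suc i) (?d + 1)"
        unfolding A_def by (rule card_mono) (use step(2)[OF i] in \<open>fastforce\<close>)+
      then show ?thesis using A_Suc[OF i, of ?d] lower[OF c] by simp
    qed
    finally show "?c \<le> ?d + 1" using le_iff[OF c'] by simp
  qed
  \<comment> \<open>Sorting puts the minimum into column \<open>0\<close>, and the minimum of row
    \<open>i\<close> is the \<open>i\<close> that stood in column \<open>0\<close> of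
    \<open>\<alpha>'\<close>.\<close>
  have zero: "\<alpha> (i, 0) = int i" if c: "(i, 0) \<in> cells n" for i
  proof (rule antisym)
    have "0 \<in> {j \<in> {0..n - i}. \<alpha>' (i, j) \<le> int i}"
      using first[of i] c by (auto simp: cells_def)
    then have "0 < A i (int i)" unfolding A_def by (subst card_gt_0_iff) auto
    then show "\<alpha> (i, 0) \<le> int i" using le_iff[OF c] by simp
  qed (rule lower[OF c])
  \<comment> \<open>\<open>down\<close> carries the bound along the antidiagonal, starting from
    column \<open>0\<close>.\<close>
  have upper: "\<alpha> (i, j) \<le> int (i + j)" if "(i, j) \<in> cells n" for i j
    using that
  proof (induction j arbitrary: i)
    case (Suc j)
    have "(Suc i, j) \<in> cells n" using Suc.prems by (auto simp: cells_def)
    from Suc.IH[OF this] down[OF Suc.prems] show ?case by simp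
  qed (simp add: zero)
  have sorted: "\<alpha> (i, j) \<le> \<alpha> (i, Suc j)" if "(i, j) \<in> cells n" "(i, Suc j) \<in> cells n" for i j
    using that mono[of j "Suc j" i] by (simp add: \<alpha>_eq cells_def)
  have "\<alpha> \<in> extensional (cells n)" by (auto simp: \<alpha>_def extensional_def)
  then have "\<alpha> \<in> Y_rbgy n"
    using zero lower upper up down sorted by (simp add: Y_rbgy_def Y_rbg_def)
  moreover have "\<alpha>' \<in> row_shuffles n \<alpha>"
    unfolding row_shuffles_def
  proof (intro CollectI conjI ballI \<alpha>')
    fix i
    assume i: "i \<in> {1..n}"
    \<comment> \<open>\<open>\<alpha>\<close> arises from \<open>\<alpha>'\<close> through
      \<open>\<sigma>\<close>, while a row shuffle expresses \<open>\<alpha>'\<close> through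
      \<open>\<alpha>\<close>.\<close>
    let ?\<tau> = "inv_into {0..n - i} (\<sigma> i)"
    have \<tau>: "bij_betw ?\<tau> {0..n - i} {0..n - i}" using \<sigma> by (rule bij_betw_inv_into)
    moreover have "\<alpha>' (i, j) = \<alpha> (i, ?\<tau> j)" if "j \<in> {0..n - i}" for j
    proof -
      have "(i, ?\<tau> j) \<in> cells n" using bij_betwE[OF \<tau>] that i by (auto simp: cells_def)
      then show ?thesis using bij_betw_inv_into_right[OF \<sigma> that] by (simp add: \<alpha>_eq)
    qed
    ultimately show "\<exists>\<sigma>. bij_betw \<sigma> {0..n - i} {0..n - i} \<and>
        (\<forall>j\<in>{0..n - i}. \<alpha>' (i, j) = \<alpha> (i, \<sigma> j))" by blast
  qed
  ultimately show ?thesis by blast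
qed

section \<open>Characterizing and counting row shuffles\<close>

lemma C_row_val_row_shuffle:
  assumes "\<alpha>' \<in> row_shuffles n \<alpha>" "i \<in> {1..n}"
  shows "C_row_val n \<alpha>' i k = C_row_val n \<alpha> i k"
proof -
  obtain \<sigma> where \<sigma>: "bij_betw \<sigma> {0..n - i} {0..n - i}"
    "\<And>j. j \<in> {0..n - i} \<Longrightarrow> \<alpha>' (i, j) = \<alpha> (i, \<sigma> j)"
    using assms unfolding row_shuffles_def by blast
  have C: "C_row_val n \<beta> i k = card {j \<in> {0..n - i}. \<beta> (i, j) = k}" for \<beta>
    using assms(2) by (auto simp: C_row_val_def cells_def intro!: arg_cong[where f = card])
  have "C_row_val n \<alpha>' i k = card {j \<in> {0..n - i}. \<alpha> (i, \<sigma> j) = k}"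
    unfolding C by (rule arg_cong[where f = card]) (use \<sigma>(2) in auto)
  also have "\<dots> = C_row_val n \<alpha> i k"
    unfolding C by (rule card_Collect_bij_betw[OF \<sigma>(1)])
  finally show ?thesis .
qed

text \<open>If the counts agree, the sorted version of \<open>\<alpha>'\<close> has the same counts
  as \<open>\<alpha>\<close>, and a sorted array is determined by them.\<close>

lemma row_shuffles_iff:
  assumes \<alpha>: "\<alpha> \<in> Y_rbgy n" and \<alpha>': "\<alpha>' \<in> Y_rbg n"
  shows "\<alpha>' \<in> row_shuffles n \<alpha> \<longleftrightarrow> (\<forall>i\<in>{1..n}. \<forall>k. C_row_val n \<alpha>' i k = C_row_val n \<alpha> i k)"
proof
  assume eq: "\<forall>i\<in>{1..n}. \<forall>k. C_row_val n \<alpha>' i k = C_row_val n \<alpha> i k"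
  obtain \<beta> where \<beta>: "\<beta> \<in> Y_rbgy n" "\<alpha>' \<in> row_shuffles n \<beta>"
    using ex_sorted_row_shuffle[OF \<alpha>'] by blast
  have "\<beta> = \<alpha>"
    using C_row_val_row_shuffle[OF \<beta>(2)] eq by (intro Y_rbgy_eqI[OF \<beta>(1) \<alpha>]) metis
  then show "\<alpha>' \<in> row_shuffles n \<alpha>" using \<beta>(2) by simp
qed (use C_row_val_row_shuffle in blast)

text \<open>Row counts and pair counts determine each other. The pair counts show that
  \<open>E_row\<close> is invariant, and they are the data that \<open>matching_above\<close>
  prescribes.\<close>

lemma row_shuffles_iff_pair_count:
  assumes \<alpha>: "\<alpha> \<in> Y_rbgy n" and \<alpha>': "\<alpha>' \<in> Y_rbg n"
  shows "\<alpha>' \<in> row_shuffles n \<alpha> \<longleftrightarrow>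
    (\<forall>i k. 1 \<le> i \<and> i < n \<longrightarrow> pair_count (pairs_of n \<alpha>') i k = pair_count (pairs_of n \<alpha>) i k)"
proof -
  have \<alpha>2: "\<alpha> \<in> Y_rbg n" using \<alpha> by (simp add: Y_rbgy_def)
  have C: "\<alpha>' \<in> row_shuffles n \<alpha> \<longleftrightarrow>
      (\<forall>i\<in>{1..n}. \<forall>k. row_count n (pairs_of n \<alpha>') i k = row_count n (pairs_of n \<alpha>) i k)"
    unfolding row_shuffles_iff[OF \<alpha> \<alpha>'] by (simp add: C_row_val_eq[OF \<alpha>2] C_row_val_eq[OF \<alpha>'])
  show ?thesis
  proof
    assume "\<alpha>' \<in> row_shuffles n \<alpha>"
    then show "\<forall>i k. 1 \<le> i \<and> i < n \<longrightarrow> pair_count (pairs_of n \<alpha>') i k = pair_count (pairs_of n \<alpha>) i k"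
      unfolding C by (intro allI impI pair_count_cong[OF pairs_of_subset pairs_of_subset]) auto
  next
    assume "\<forall>i k. 1 \<le> i \<and> i < n \<longrightarrow> pair_count (pairs_of n \<alpha>') i k = pair_count (pairs_of n \<alpha>) i k"
    then show "\<alpha>' \<in> row_shuffles n \<alpha>"
      unfolding C by (intro ballI allI row_count_cong[OF pairs_of_subset pairs_of_subset]) auto
  qed
qed

lemma E_row_row_shuffle:
  assumes "\<alpha> \<in> Y_rbgy n" "\<alpha>' \<in> row_shuffles n \<alpha>" "i \<in> {1..n - 1}"
  shows "E_row n \<alpha>' i = E_row n \<alpha> i"
proof -
  have "\<alpha>' \<in> Y_rbg n" using assms(2) by (simp add: row_shuffles_def)
  then have "pair_count (pairs_of n \<alpha>') i k = pair_count (pairs_of n \<alpha>) i k" for k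
    using row_shuffles_iff_pair_count[OF assms(1), of \<alpha>'] assms(2,3) by auto
  then show ?thesis
    by (simp add: E_row_eq card_row_eq_sum_pair_count[OF pairs_of_subset])
qed

lemma E_total_row_shuffle:
  assumes "\<alpha> \<in> Y_rbgy n" "\<alpha>' \<in> row_shuffles n \<alpha>"
  shows "E_total n \<alpha>' = E_total n \<alpha>"
  using E_row_row_shuffle[OF assms]
  by (simp add: E_total_eq card_eq_sum_rows[OF pairs_of_subset] E_row_eq)

text \<open>\<open>pairs_of\<close> turns the row shuffles into \<open>matching_above\<close> from
  row \<open>1\<close>, whose size is a product of binomials. There \<open>k\<close> runs up to
  \<open>n\<close>; here it stops at \<open>n - 1\<close>, the factor for \<open>n\<close> being
  \<open>1\<close>.\<close>

lemma card_row_shuffles: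
  assumes \<alpha>: "\<alpha> \<in> Y_rbgy n" and n: "1 \<le> n"
  shows "card (row_shuffles n \<alpha>) = (\<Prod>(i, k)\<in>{(i, k). 1 \<le> i \<and> i \<le> k \<and> k \<le> n - 1}.
    C_row_val n \<alpha> (i + 1) (int k) choose E_row_val n \<alpha> i (int k))"
proof -
  let ?S = "pairs_of n \<alpha>"
  have \<alpha>2: "\<alpha> \<in> Y_rbg n" using \<alpha> by (simp add: Y_rbgy_def)
  have "bij_betw (pairs_of n) (row_shuffles n \<alpha>) (matching_above n ?S 1)"
  proof (rule bij_betw_byWitness[where f' = "array_of n"], goal_cases)
    case 1
    then show ?case by (auto simp: row_shuffles_def array_of_pairs_of)
  next
    case 2
    then show ?case by (auto simp: matching_above_def pairs_of_array_of)
  next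
    case 3
    show ?case
    proof (rule image_subsetI)
      fix \<alpha>'
      assume s: "\<alpha>' \<in> row_shuffles n \<alpha>"
      then have "\<alpha>' \<in> Y_rbg n" by (simp add: row_shuffles_def)
      from row_shuffles_iff_pair_count[OF \<alpha> this] s show "pairs_of n \<alpha>' \<in> matching_above n ?S 1"
        using pairs_of_subset[of n \<alpha>'] by (auto simp: matching_above_def pairs_def)
    qed
  next
    case 4
    show ?case
    proof (rule image_subsetI)
      fix S
      assume S: "S \<in> matching_above n ?S 1"
      then have sub: "S \<subseteq> pairs n" by (auto simp: matching_above_def)
      show "array_of n S \<in> row_shuffles n \<alpha>"
        using S row_shuffles_iff_pair_count[OF \<alpha> array_of_in_Y_rbg[OF sub]]
        by (auto simp: matching_above_def pairs_of_array_of[OF sub])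
    qed
  qed
  then have "card (row_shuffles n \<alpha>) =
      (\<Prod>i\<in>{1..<n}. \<Prod>k\<in>{int i..int n}. row_count n ?S (Suc i) k choose pair_count ?S i k)"
    using card_matching_above[OF pairs_of_subset, of 1] n by (simp add: bij_betw_same_card)
  also have "\<dots> = (\<Prod>i\<in>{1..<n}. \<Prod>k\<in>{i..n - 1}.
      C_row_val n \<alpha> (i + 1) (int k) choose E_row_val n \<alpha> i (int k))"
  proof (rule prod.cong)
    fix i
    assume "i \<in> {1..<n}"
    then have i: "1 \<le> i" "i < n" by auto
    \<comment> \<open>The value \<open>n\<close> can only be attained at the end of a row.\<close>
    have top: "row_count n ?S (Suc i) (int n) choose pair_count ?S i (int n) = 1"
    proof -
      \<comment> \<open>A kept \<open>n\<close> in row \<open>i\<close> sits above an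
        \<open>n\<close> in row \<open>Suc i\<close>, and that row has at most one; so only
        \<open>0 choose 0\<close>, \<open>1 choose 0\<close> and \<open>1 choose 1\<close> can
        occur.\<close>
      have "pair_count ?S i (int n) \<le> row_count n ?S (Suc i) (int n)"
        unfolding pair_count_def row_count_def
        using level_step[OF pairs_of_subset, of n \<alpha> i] pairs_of_subset[of n \<alpha>]
        by (intro card_mono) (auto simp: pairs_def)
      moreover have "row_count n ?S (Suc i) (int n) \<le> card {n}"
        unfolding row_count_def
      proof (rule card_mono)
        show "{m \<in> {Suc i..n}. level ?S (Suc i) m = int n} \<subseteq> {n}"
        proof
          fix m
          assume "m \<in> {m \<in> {Suc i..n}. level ?S (Suc i) m = int n}"
          then show "m \<in> {n}"
            using level_bounds(2)[OF pairs_of_subset, of "Suc i" m n \<alpha>] by auto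
        qed
      qed simp
      ultimately show ?thesis
        by (cases "pair_count ?S i (int n)"; cases "row_count n ?S (Suc i) (int n)") auto
    qed
    have "{int i..int n} = int ` {i..n}" by (simp add: image_int_atLeastAtMost)
    then have "(\<Prod>k\<in>{int i..int n}. row_count n ?S (Suc i) k choose pair_count ?S i k) =
        (\<Prod>k\<in>{i..n}. row_count n ?S (Suc i) (int k) choose pair_count ?S i (int k))"
      by (simp add: prod.reindex)
    also have "{i..n} = insert n {i..n - 1}" using i by auto
    also have "(\<Prod>k\<in>\<dots>. row_count n ?S (Suc i) (int k) choose pair_count ?S i (int k)) =
        (\<Prod>k\<in>{i..n - 1}. row_count n ?S (Suc i) (int k) choose pair_count ?S i (int k))"
      using i by (subst prod.insert) (auto simp: top)
    finally show "(\<Prod>k\<in>{int i..int n}. row_count n ?S (Suc i) k choose pair_count ?S i k) =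
        (\<Prod>k\<in>{i..n - 1}. C_row_val n \<alpha> (i + 1) (int k) choose E_row_val n \<alpha> i (int k))"
      using i by (simp add: C_row_val_eq[OF \<alpha>2] E_row_val_eq[OF \<alpha>2])
  qed simp
  also have "\<dots> = (\<Prod>(i, k)\<in>(SIGMA i:{1..<n}. {i..n - 1}).
      C_row_val n \<alpha> (i + 1) (int k) choose E_row_val n \<alpha> i (int k))"
    by (rule prod.Sigma) auto
  also have "(SIGMA i:{1..<n}. {i..n - 1}) = {(i, k). 1 \<le> i \<and> i \<le> k \<and> k \<le> n - 1}"
    by auto
  finally show ?thesis .
qed

section \<open>Expansion of the product\<close>

lemma prod_pairs_choice:
  fixes x :: "nat \<Rightarrow> 'a::comm_semiring_1"
  assumes S: "S \<subseteq> pairs n"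
  shows "(\<Prod>(i, m)\<in>S. l * x m) * (\<Prod>(i, m)\<in>pairs n - S. x i) =
    l ^ card S * (\<Prod>i = 1..n - 1. x i ^ (n - i - card {m. (i, m) \<in> S})) *
    (\<Prod>m = 1..n. x m ^ card {i. (i, m) \<in> S})"
proof -
  have fin: "finite S" "finite (pairs n - S)" using S finite_pairs finite_subset by auto
  have "(\<Prod>(i, m)\<in>S. l * x m) = l ^ card S * (\<Prod>p\<in>S. x (snd p))"
    by (simp add: case_prod_unfold prod.distrib)
  \<comment> \<open>\<open>S\<close> holds the pairs whose factor contributes
    \<open>l * x m\<close>; they are grouped by \<open>m\<close>, the remaining pairs below by
    \<open>i\<close>.\<close>
  also have "(\<Prod>p\<in>S. x (snd p)) = (\<Prod>m = 1..n. \<Prod>p\<in>{p \<in> S. snd p = m}. x (snd p))"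
    by (rule prod.group[symmetric]) (use fin S in \<open>auto simp: pairs_def\<close>)
  also have "\<dots> = (\<Prod>m = 1..n. x m ^ card {i. (i, m) \<in> S})"
  proof (rule prod.cong)
    fix m
    have "{p \<in> S. snd p = m} = (\<lambda>i. (i, m)) ` {i. (i, m) \<in> S}" by force
    then have "card {p \<in> S. snd p = m} = card {i. (i, m) \<in> S}"
      by (simp add: card_image inj_on_def)
    then show "(\<Prod>p\<in>{p \<in> S. snd p = m}. x (snd p)) = x m ^ card {i. (i, m) \<in> S}" by simp
  qed simp
  finally have 1: "(\<Prod>(i, m)\<in>S. l * x m) = l ^ card S * (\<Prod>m = 1..n. x m ^ card {i. (i, m) \<in> S})" .
  have "(\<Prod>(i, m)\<in>pairs n - S. x i) = (\<Prod>p\<in>pairs n - S. x (fst p))"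
    by (simp add: case_prod_unfold)
  also have "\<dots> = (\<Prod>i = 1..n - 1. \<Prod>p\<in>{p \<in> pairs n - S. fst p = i}. x (fst p))"
    by (rule prod.group[symmetric]) (use fin in \<open>auto simp: pairs_def\<close>)
  also have "\<dots> = (\<Prod>i = 1..n - 1. x i ^ (n - i - card {m. (i, m) \<in> S}))"
  proof (rule prod.cong)
    fix i
    assume "i \<in> {1..n - 1}"
    \<comment> \<open>Of the \<open>n - i\<close> pairs in row \<open>i\<close>, those outside
      \<open>S\<close> contribute \<open>x i\<close>.\<close>
    then have "{p \<in> pairs n - S. fst p = i} = Pair i ` ({Suc i..n} - {m. (i, m) \<in> S})"
      by (auto simp: pairs_def)
    moreover have "{m. (i, m) \<in> S} \<subseteq> {Suc i..n}" using S by (auto simp: pairs_def)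
    ultimately have "card {p \<in> pairs n - S. fst p = i} = n - i - card {m. (i, m) \<in> S}"
      using finite_pair_row[OF S] by (simp add: card_image inj_on_def card_Diff_subset)
    then show "(\<Prod>p\<in>{p \<in> pairs n - S. fst p = i}. x (fst p)) = x i ^ (n - i - card {m. (i, m) \<in> S})"
      by simp
  qed simp
  finally show ?thesis by (simp add: 1 mult_ac)
qed

text \<open>Stated for arbitrary elements \<open>x\<close> and \<open>l\<close> of a commutative
  semiring, so that both identities of the theorem are instances: the indeterminates, and all
  \<open>x i\<close> equal to \<open>1\<close>.\<close>

lemma prod_pairs_eq_sum_Y_rbgy:
  fixes x :: "nat \<Rightarrow> 'a::comm_semiring_1"
  shows "(\<Prod>(i, j)\<in>pairs n. x i + l * x j) =
    (\<Sum>\<alpha>\<in>Y_rbgy n. l ^ E_total n \<alpha> * (\<Prod>i = 1..n - 1. x i ^ (n - i - E_row n \<alpha> i)) *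
      (\<Sum>\<alpha>'\<in>row_shuffles n \<alpha>. \<Prod>m = 1..n. x m ^ E_diag n \<alpha>' m))"
proof -
  define w where "w \<alpha> = l ^ E_total n \<alpha> * (\<Prod>i = 1..n - 1. x i ^ (n - i - E_row n \<alpha> i)) *
    (\<Prod>m = 1..n. x m ^ E_diag n \<alpha> m)" for \<alpha>
  have "(\<Prod>(i, j)\<in>pairs n. x i + l * x j) = (\<Prod>p\<in>pairs n. l * x (snd p) + x (fst p))"
    by (simp add: case_prod_unfold add.commute)
  also have "\<dots> = (\<Sum>S\<in>Pow (pairs n). (\<Prod>(i, m)\<in>S. l * x m) * (\<Prod>(i, m)\<in>pairs n - S. x i))"
    by (simp add: prod_add[OF finite_pairs] case_prod_unfold)
  also have "\<dots> = (\<Sum>S\<in>Pow (pairs n).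
      l ^ card S * (\<Prod>i = 1..n - 1. x i ^ (n - i - card {m. (i, m) \<in> S})) *
      (\<Prod>m = 1..n. x m ^ card {i. (i, m) \<in> S}))"
    by (rule sum.cong) (simp_all add: prod_pairs_choice)
  also have "\<dots> = (\<Sum>\<alpha>\<in>Y_rbg n. w \<alpha>)"
    by (rule sum.reindex_bij_witness[of _ "pairs_of n" "array_of n"])
      (simp_all add: pairs_of_array_of array_of_pairs_of array_of_in_Y_rbg pairs_of_subset
        w_def E_total_eq E_row_eq E_diag_eq)
  also have "Y_rbg n = (\<Union>\<alpha>\<in>Y_rbgy n. row_shuffles n \<alpha>)"
    using ex_sorted_row_shuffle by (auto simp: row_shuffles_def)
  also have "(\<Sum>\<alpha>\<in>\<dots>. w \<alpha>) = (\<Sum>\<alpha>\<in>Y_rbgy n. \<Sum>\<alpha>'\<in>row_shuffles n \<alpha>. w \<alpha>')"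
  proof (rule sum.UNION_disjoint)
    \<comment> \<open>A common row shuffle has the row counts of both sorted arrays, which therefore
      coincide.\<close>
    have "\<alpha> = \<beta>" if "\<alpha> \<in> Y_rbgy n" "\<beta> \<in> Y_rbgy n" "\<gamma> \<in> row_shuffles n \<alpha>" "\<gamma> \<in> row_shuffles n \<beta>"
      for \<alpha> \<beta> \<gamma>
      using C_row_val_row_shuffle[OF that(3)] C_row_val_row_shuffle[OF that(4)]
      by (intro Y_rbgy_eqI[OF that(1,2)]) metis
    then show "\<forall>\<alpha>\<in>Y_rbgy n. \<forall>\<beta>\<in>Y_rbgy n. \<alpha> \<noteq> \<beta> \<longrightarrow> row_shuffles n \<alpha> \<inter> row_shuffles n \<beta> = {}"
      by blast
  qed (simp_all add: finite_Y_rbgy finite_row_shuffles)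
  also have "\<dots> = (\<Sum>\<alpha>\<in>Y_rbgy n. l ^ E_total n \<alpha> * (\<Prod>i = 1..n - 1. x i ^ (n - i - E_row n \<alpha> i)) *
      (\<Sum>\<alpha>'\<in>row_shuffles n \<alpha>. \<Prod>m = 1..n. x m ^ E_diag n \<alpha>' m))"
    by (auto simp: w_def sum_distrib_left E_total_row_shuffle E_row_row_shuffle intro!: sum.cong)
  finally show ?thesis .
qed

theorem theorem6p4:
  fixes n :: nat
  assumes "n \<ge> 1"
  shows "(\<Prod>(i, j)\<in>{(i, j). 1 \<le> i \<and> i < j \<and> j \<le> n}. xv i + lam * xv j) =
           (\<Sum>\<alpha>\<in>Y_rbgy n. lam ^ E_total n \<alpha> *
              (\<Prod>i = 1..n - 1. xv i ^ (n - i - E_row n \<alpha> i)) *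
              (\<Sum>\<alpha>'\<in>row_shuffles n \<alpha>. \<Prod>m = 1..n. xv m ^ E_diag n \<alpha>' m))
         \<and>
         (1 + lam) ^ (n choose 2) =
           (\<Sum>\<alpha>\<in>Y_rbgy n. lam ^ E_total n \<alpha> *
              (\<Prod>(i, k)\<in>{(i, k). 1 \<le> i \<and> i \<le> k \<and> k \<le> n - 1}.
                 of_nat (C_row_val n \<alpha> (i + 1) (int k) choose E_row_val n \<alpha> i (int k))))"
proof
  show "(\<Prod>(i, j)\<in>{(i, j). 1 \<le> i \<and> i < j \<and> j \<le> n}. xv i + lam * xv j) =
      (\<Sum>\<alpha>\<in>Y_rbgy n. lam ^ E_total n \<alpha> *
        (\<Prod>i = 1..n - 1. xv i ^ (n - i - E_row n \<alpha> i)) *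
        (\<Sum>\<alpha>'\<in>row_shuffles n \<alpha>. \<Prod>m = 1..n. xv m ^ E_diag n \<alpha>' m))"
    using prod_pairs_eq_sum_Y_rbgy[of xv lam n] by (simp only: pairs_def)
  \<comment> \<open>With all \<open>x i\<close> set to \<open>1\<close>, the inner sum becomes the
    number of row shuffles.\<close>
  have "(1 + lam) ^ (n choose 2) = (\<Sum>\<alpha>\<in>Y_rbgy n. lam ^ E_total n \<alpha> * of_nat (card (row_shuffles n \<alpha>)))"
    using prod_pairs_eq_sum_Y_rbgy[of "\<lambda>_. 1" lam n] by (simp add: card_pairs case_prod_unfold)
  then show "(1 + lam) ^ (n choose 2) =
      (\<Sum>\<alpha>\<in>Y_rbgy n. lam ^ E_total n \<alpha> *
        (\<Prod>(i, k)\<in>{(i, k). 1 \<le> i \<and> i \<le> k \<and> k \<le> n - 1}.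
          of_nat (C_row_val n \<alpha> (i + 1) (int k) choose E_row_val n \<alpha> i (int k))))"
    using assms by (simp add: card_row_shuffles of_nat_prod case_prod_unfold)
qed

end
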